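(* The operator $\Theta$ is a Banach space isomorphism which is a linear isometry between the Banach spaces $(\mathscr{D}[0,1],\|\cdot\|_\infty)$ and $(C(\Omega),\|\cdot\|_\infty)$; that is, $\Theta:\mathscr{D}[0,1]\to C(\Omega)$ is a linear bijection satisfying $\|\Theta(F)\|_\infty=\|F\|_\infty$ for every $F\in\mathscr{D}[0,1]$.
   Context: Let $\Omega=\{0,1\}^{\mathbb{N}}$ with $\mathbb{N}=\{1,2,\ldots\}$, a compact metric space with the metric $d(x,y)=2^{-N}$, $N=\inf\{i\in\mathbb{N}: x_i\neq y_i\}$ (and $d(x,x)=0$). $C(\Omega)$ is the space of real continuous functions on $\Omega$, with the supremum norm $\|\cdot\|_\infty$. Define $t:\Omega\to[0,1]$ by $t(x)=\sum_{n\ge 1}2^{-n}x_n$, and let $\mathscr{D}=\{s\in[0,1]:\#t^{-1}(s)=2\}$ be the set of points with exactly two distinct binary expansions. If $t(x)\in\mathscr{D}$ there is a unique $y\in\Omega\setminus\{x\}$ with $t(x)=t(y)$; $\prec_{\mathrm{Lex}}$ denotes the (strict) lexicographic order on $\Omega$. $\mathscr{D}[0,1]$ is the set of functions $F:[0,1]\to\mathbb{R}$ such that $F$ is continuous at every point of $[0,1]\setminus\mathscr{D}$ and, for every $t\in\mathscr{D}$, the left limit $\lim_{s\uparrow t}F(s)$ exists (in $\mathbb{R}$) and the right limit satisfies $\lim_{s\downarrow t}F(s)=F(t)$. It is equipped with the supremum norm $\|F\|_\infty=\sup_{s\in[0,1]}|F(s)|$. For $F\in\mathscr{D}[0,1]$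 the function $f=\Theta(F):\Omega\to\mathbb{R}$ is defined by: $f(x)=F(t(x))$ if $t(x)\notin\mathscr{D}$; and if $t(x)=t(y)\in\mathscr{D}$ with $x\prec_{\mathrm{Lex}}y$, then $f(x)=\lim_{s\uparrow t(x)}F(s)$ and $f(y)=\lim_{s\downarrow t(y)}F(s)=F(t(y))$. *)

theory Defs
  imports "HOL-Analysis.Analysis" "HOL-Library.Fun_Lexorder"
begin

text \<open>The space \<open>\<Omega> = {0,1}\<^sup>\<nat>\<close> with coordinates indexed by \<open>1, 2, \<dots>\<close>;
  \<open>digit x i\<close> is the \<open>i\<close>-th coordinate.\<close>

typedef bitseq = "{1..} \<rightarrow>\<^sub>E {0, 1} :: (nat \<Rightarrow> nat) set"
  morphisms digit Abs_bitseq
  by (auto simp: PiE_eq_empty_iff ex_in_conv)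

lemma digit_eqI:
  assumes "\<And>i. 1 \<le> i \<Longrightarrow> digit x i = digit y i"
  shows "x = y"
proof -
  have "digit x = digit y"
    by (rule PiE_ext[OF digit[of x] digit[of y]]) (use assms in auto)
  then show ?thesis by (simp add: digit_inject)
qed

instantiation bitseq :: metric_space
begin

definition dist_bitseq :: "bitseq \<Rightarrow> bitseq \<Rightarrow> real" where
  "dist x y = (if x = y then 0 else (1 / 2) ^ Inf {i. 1 \<le> i \<and> digit x i \<noteq> digit y i})"

definition uniformity_bitseq :: "(bitseq \<times> bitseq) filter" where
  "(uniformity :: (bitseq \<times> bitseq) filter) = (INF e\<in>{0 <..}. principal {(x, y). dist x y < e})"

definition open_bitseq :: "bitseq set \<Rightarrow> bool" where
  "open (U :: bitseq set) \<longleftrightarrow> (\<forall>x\<in>U. \<forall>\<^sub>F (x', y) in uniformity. x' = x \<longrightarrow> y \<in> U)"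

instance
proof
  fix x y z :: bitseq
  let ?S = "\<lambda>x y. {i. 1 \<le> i \<and> digit x i \<noteq> digit y i}"
  show "dist x y = 0 \<longleftrightarrow> x = y"
    by (simp add: dist_bitseq_def)
  show "dist x y \<le> dist x z + dist y z"
  proof (cases "x = y \<or> x = z \<or> y = z")
    case True
    have "?S x y = ?S y x" by auto
    with True show ?thesis
      by (auto simp: dist_bitseq_def)
  next
    case False
    have "?S x y \<noteq> {}" using False digit_eqI[of x y] by blast
    then have "Inf (?S x y) \<in> ?S x y" by (rule Inf_nat_def1)
    then have "Inf (?S x y) \<in> ?S x z \<or> Inf (?S x y) \<in> ?S y z" by auto
    then have "Inf (?S x z) \<le> Inf (?S x y) \<or> Inf (?S y z) \<le> Inf (?S x y)"
      by (metis (lifting) wellorder_Inf_le1)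
    then have "(1 / 2 :: real) ^ Inf (?S x y) \<le> (1 / 2) ^ Inf (?S x z) \<or>
        (1 / 2 :: real) ^ Inf (?S x y) \<le> (1 / 2) ^ Inf (?S y z)"
      by (auto intro: power_decreasing)
    moreover have "dist x y = (1 / 2) ^ Inf (?S x y)" "dist x z = (1 / 2) ^ Inf (?S x z)"
        "dist y z = (1 / 2) ^ Inf (?S y z)"
      using False by (simp_all add: dist_bitseq_def)
    moreover have "0 \<le> (1 / 2 :: real) ^ Inf (?S x z)" "0 \<le> (1 / 2 :: real) ^ Inf (?S y z)"
      by simp_all
    ultimately show ?thesis by linarith
  qed
qed (simp_all only: uniformity_bitseq_def open_bitseq_def)

end

text \<open>The coordinate functions agree at the dummy index \<open>0\<close>, so \<^term>\<open>less_fun\<close> compares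
  the coordinates from \<open>1\<close> onwards.\<close>

definition lex_less :: "bitseq \<Rightarrow> bitseq \<Rightarrow> bool" where
  "lex_less x y \<longleftrightarrow> less_fun (digit x) (digit y)"

definition binval :: "bitseq \<Rightarrow> real" where
  "binval x = (\<Sum>n. real (digit x (Suc n)) / 2 ^ Suc n)"

definition two_expansions :: "real set" where
  "two_expansions = {s \<in> {0..1}. card (binval -` {s}) = 2}"

text \<open>A function on \<open>[0,1]\<close> is represented by a function on \<open>\<real>\<close> that vanishes outside
  \<open>[0,1]\<close>; all limits are taken within \<open>[0,1]\<close>, so the values outside play no role.\<close>

definition D01 :: "(real \<Rightarrow> real) set" where
  "D01 = {F. (\<forall>s. s \<notin> {0..1} \<longrightarrow> F s = 0) \<and>
     (\<forall>s\<in>{0..1} - two_expansions. continuous (at s within {0..1}) F) \<and>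
     (\<forall>s\<in>two_expansions.
        (\<exists>l. (F \<longlongrightarrow> l) (at s within {0..<s})) \<and> (F \<longlongrightarrow> F s) (at s within {s<..1}))}"

definition C_Omega :: "(bitseq \<Rightarrow> real) set" where
  "C_Omega = {f. continuous_on UNIV f}"

definition sup_norm_on :: "'a set \<Rightarrow> ('a \<Rightarrow> real) \<Rightarrow> real" where
  "sup_norm_on S f = (SUP s\<in>S. \<bar>f s\<bar>)"

text \<open>\<open>V\<close>, with pointwise operations and the supremum norm over \<open>S\<close>, is a real Banach space.
  Boundedness is demanded explicitly because the supremum of an unbounded set of reals is
  an unspecified real number.\<close>

definition sup_norm_banach :: "'a set \<Rightarrow> ('a \<Rightarrow> real) set \<Rightarrow> bool" where
  "sup_norm_banach S V \<longleftrightarrow>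
     (\<lambda>_. 0) \<in> V \<and>
     (\<forall>f\<in>V. \<forall>g\<in>V. (\<lambda>s. f s + g s) \<in> V) \<and>
     (\<forall>c. \<forall>f\<in>V. (\<lambda>s. c * f s) \<in> V) \<and>
     (\<forall>f\<in>V. bounded (f ` S)) \<and>
     (\<forall>f\<in>V. 0 \<le> sup_norm_on S f) \<and>
     (\<forall>f\<in>V. sup_norm_on S f = 0 \<longleftrightarrow> f = (\<lambda>_. 0)) \<and>
     (\<forall>c. \<forall>f\<in>V. sup_norm_on S (\<lambda>s. c * f s) = \<bar>c\<bar> * sup_norm_on S f) \<and>
     (\<forall>f\<in>V. \<forall>g\<in>V. sup_norm_on S (\<lambda>s. f s + g s) \<le> sup_norm_on S f + sup_norm_on S g) \<and>
     (\<forall>u. (\<forall>n. u n \<in> V) \<and>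
          (\<forall>e>0. \<exists>N::nat. \<forall>m\<ge>N. \<forall>n\<ge>N. sup_norm_on S (\<lambda>s. u m s - u n s) < e) \<longrightarrow>
        (\<exists>f\<in>V. (\<lambda>n. sup_norm_on S (\<lambda>s. u n s - f s)) \<longlonglongrightarrow> 0))"

definition Theta :: "(real \<Rightarrow> real) \<Rightarrow> bitseq \<Rightarrow> real" where
  "Theta F x =
     (if binval x \<notin> two_expansions then F (binval x)
      else if \<exists>y. binval y = binval x \<and> lex_less x y
        then Lim (at (binval x) within {0..<binval x}) F
      else Lim (at (binval x) within {binval x<..1}) F)"

end

theory Submission
  imports Defs
begin

text \<open>If \<open>x\<close> lexicographically precedes \<open>y\<close> and both expand \<open>s\<close>, then \<open>x\<close> ends in ones and \<open>y\<close> in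
  zeros, so every sequence near \<open>x\<close> and different from it has value below \<open>s\<close>, and every one near
  \<open>y\<close> has value above \<open>s\<close>. Hence one-sided limits of \<open>F\<close> at \<open>s\<close> are ordinary limits of
  \<open>Theta F\<close> at \<open>x\<close> and \<open>y\<close>. Conversely, \<open>binval\<close> is a closed map because \<open>\<Omega>\<close> is compact, so
  points of \<open>[0,1]\<close> close to \<open>s\<close> on one side have all their expansions close to the
  corresponding expansion of \<open>s\<close>; thus evaluating a continuous \<open>f\<close> at the lexicographically
  greatest expansion gives the inverse of \<open>Theta\<close>. The values of \<open>F\<close> are values of
  \<open>Theta F\<close>, which in turn are limits of values of \<open>F\<close>, so the norms agree, and the completeness
  of \<open>D01\<close> is inherited from that of \<open>C_Omega\<close>.\<close>

section \<open>Binary expansions\<close>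

lemma digit_cases: "1 \<le> i \<Longrightarrow> digit x i = 0 \<or> digit x i = 1"
  using digit[of x] by (fastforce dest: PiE_mem)

text \<open>Elements of \<open>PiE\<close> are \<open>undefined\<close> off the index set, so all
  sequences agree at index \<open>0\<close> and conditions on initial segments may start
  there.\<close>

lemma digit_0: "digit x 0 = undefined"
  using digit[of x] by (auto dest: PiE_arb)

section \<open>Lexicographic order and distance\<close>

lemma lex_lessE:
  assumes "lex_less x y"
  obtains k where "1 \<le> k" "digit x k = 0" "digit y k = 1" "\<And>i. i < k \<Longrightarrow> digit x i = digit y i"
proof -
  from assms obtain k where k: "digit x k < digit y k" "\<And>i. i < k \<Longrightarrow> digit x i = digit y i"
    unfolding lex_less_def less_fun_def by blast
  have "1 \<le> k" using k(1) digit_0[of x] digit_0[of y] by (cases k) auto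
  moreover from this have "digit x k = 0" "digit y k = 1"
    using k(1) digit_cases[of k x] digit_cases[of k y] by auto
  ultimately show ?thesis using that k(2) by blast
qed

lemma lex_lessI:
  assumes "digit x k < digit y k" "\<And>i. i < k \<Longrightarrow> digit x i = digit y i"
  shows "lex_less x y"
  unfolding lex_less_def using assms by (intro less_funI) blast

lemma first_difference:
  assumes "x \<noteq> y"
  obtains k where "1 \<le> k" "digit x k \<noteq> digit y k" "\<And>i. i < k \<Longrightarrow> digit x i = digit y i"
proof -
  have ex: "\<exists>i. digit x i \<noteq> digit y i"
    using assms digit_eqI by blast
  define k where "k = (LEAST i. digit x i \<noteq> digit y i)"
  have "digit x k \<noteq> digit y k" unfolding k_def by (rule LeastI_ex[OF ex])
  moreover have "digit x i = digit y i" if "i < k" for i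
    using not_less_Least that unfolding k_def by blast
  moreover have "1 \<le> k" using calculation(1) digit_0 by (cases k) auto
  ultimately show ?thesis using that by blast
qed

lemma lex_less_linear: "x \<noteq> y \<Longrightarrow> lex_less x y \<or> lex_less y x"
  by (metis first_difference lex_lessI linorder_neqE_nat)

lemma dist_bitseq_first_difference:
  assumes "1 \<le> k" "digit x k \<noteq> digit y k" "\<And>i. i < k \<Longrightarrow> digit x i = digit y i"
  shows "dist x y = (1 / 2) ^ k"
proof -
  have "Inf {i. 1 \<le> i \<and> digit x i \<noteq> digit y i} = k"
    by (rule cInf_eq_minimum) (use assms not_le in auto)
  then show ?thesis using assms(2) by (auto simp: dist_bitseq_def)
qed

text \<open>Balls of radius \<open>(1 / 2) ^ k\<close> are cylinders: distinct points have distance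
  \<open>(1 / 2) ^ j\<close> with \<open>j\<close> the first difference, and strictness means
  \<open>k < j\<close>, so index \<open>k\<close> itself is included.\<close>

lemma dist_bitseq_less_iff:
  "dist x y < (1 / 2) ^ k \<longleftrightarrow> (\<forall>i\<le>k. digit x i = digit y i)"
proof (cases "x = y")
  case False
  then obtain j where j: "1 \<le> j" "digit x j \<noteq> digit y j" "\<And>i. i < j \<Longrightarrow> digit x i = digit y i"
    by (rule first_difference) blast
  have "dist x y < (1 / 2) ^ k \<longleftrightarrow> k < j"
    by (simp add: dist_bitseq_first_difference[OF j] power_strict_decreasing_iff del: power_divide)
  also have "\<dots> \<longleftrightarrow> (\<forall>i\<le>k. digit x i = digit y i)"
    using j by (metis le_less_trans not_le)
  finally show ?thesis .
qed simp

section \<open>Values of expansions as series\<close>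

lemma geometric_tail_sums:
  "(\<lambda>n. if n < k then 0 else 1 / 2 ^ Suc n) sums (1 / 2 ^ k :: real)"
proof -
  have "(\<lambda>n. 1 / 2 ^ k * (1 / 2) ^ Suc n) sums (1 / 2 ^ k * 1 :: real)"
    by (intro sums_mult power_half_series)
  then have "(\<lambda>n. if n + k < k then 0 else 1 / 2 ^ Suc (n + k)) sums (1 / 2 ^ k :: real)"
    by (simp add: power_add power_divide mult_ac)
  then show ?thesis
    by (subst (asm) sums_iff_shift) simp
qed

lemma binval_sums: "(\<lambda>n. real (digit x (Suc n)) / 2 ^ Suc n) sums binval x"
proof -
  have "summable (\<lambda>n. real (digit x (Suc n)) / 2 ^ Suc n)"
  proof (rule summable_comparison_test')
    show "summable (\<lambda>n. (1 / 2 :: real) ^ Suc n)"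
      using power_half_series by (rule sums_summable)
    show "norm (real (digit x (Suc n)) / 2 ^ Suc n) \<le> (1 / 2) ^ Suc n" if "0 \<le> n" for n
      using digit_cases[of "Suc n" x] by (auto simp: power_divide)
  qed
  then show ?thesis unfolding binval_def by (rule summable_sums)
qed

text \<open>The leading \<open>1/2\<^sup>k\<close> of the difference is spread over the tail as a geometric series, which
  makes every term nonnegative.\<close>

lemma binval_diff_sums:
  assumes "1 \<le> k" "digit x k = 0" "digit y k = 1" "\<And>i. i < k \<Longrightarrow> digit x i = digit y i"
  shows "(\<lambda>n. if n < k then 0 else (1 + real (digit y (Suc n)) - real (digit x (Suc n))) / 2 ^ Suc n)
    sums (binval y - binval x)"
proof -
  have "(\<lambda>n. real (digit y (Suc n)) / 2 ^ Suc n - real (digit x (Suc n)) / 2 ^ Suc n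
      + (if n < k then 0 else 1 / 2 ^ Suc n) - (if n = k - 1 then 1 / 2 ^ k else 0))
    sums (binval y - binval x + 1 / 2 ^ k - 1 / 2 ^ k)"
    by (intro sums_add sums_diff binval_sums geometric_tail_sums sums_single)
  moreover have "real (digit y (Suc n)) / 2 ^ Suc n - real (digit x (Suc n)) / 2 ^ Suc n
      + (if n < k then 0 else 1 / 2 ^ Suc n) - (if n = k - 1 then 1 / 2 ^ k else 0)
    = (if n < k then 0 else (1 + real (digit y (Suc n)) - real (digit x (Suc n))) / 2 ^ Suc n)" for n
  proof -
    \<comment> \<open>Term \<open>n\<close> carries position \<open>Suc n\<close>. At position
      \<open>k\<close> the unit difference of digits cancels against \<open>1 / 2 ^ k\<close>;
      before it the digits agree; after it the geometric tail supplies the \<open>1\<close>.\<close>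
    consider "n = k - 1" | "n < k - 1" | "n \<ge> k" by linarith
    then show ?thesis
    proof cases
      case 1
      then have "Suc n = k" using assms(1) by simp
      then show ?thesis using assms by auto
    next
      case 2
      then show ?thesis using assms(4)[of "Suc n"] by simp
    next
      case 3
      then show ?thesis using assms(1) by (auto simp: add_divide_distrib diff_divide_distrib)
    qed
  qed
  ultimately show ?thesis by simp
qed

lemma digit_le_1: "digit x (Suc n) \<le> 1"
  using digit_cases[of "Suc n" x] by auto

text \<open>Digits are at most \<open>1\<close>, so every term of the series in
  \<open>binval_diff_sums\<close> is nonnegative.\<close>

lemma lex_less_binval_le:
  assumes "lex_less x y"
  shows "binval x \<le> binval y"
proof -
  obtain k where k: "1 \<le> k" "digit x k = 0" "digit y k = 1" "\<And>i. i < k \<Longrightarrow> digit x i = digit y i"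
    using assms by (rule lex_lessE) blast
  have "0 \<le> binval y - binval x"
    by (rule sums_le[OF _ sums_zero binval_diff_sums[OF k]])
      (use digit_le_1[of x] in \<open>auto intro!: divide_nonneg_nonneg simp: add_increasing2\<close>)
  then show ?thesis by simp
qed

text \<open>Nonnegative terms with sum zero all vanish, and
  \<open>1 + digit y i - digit x i = 0\<close> leaves only one choice of binary digits.\<close>

lemma binval_eq_tails:
  assumes k: "1 \<le> k" "digit x k = 0" "digit y k = 1" "\<And>i. i < k \<Longrightarrow> digit x i = digit y i"
    and "binval x = binval y" and "k < i"
  shows "digit x i = 1 \<and> digit y i = 0"
proof -
  let ?f = "\<lambda>n. if n < k then 0 else (1 + real (digit y (Suc n)) - real (digit x (Suc n))) / 2 ^ Suc n"
  have f: "?f sums 0" using binval_diff_sums[OF k] assms(5) by simp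
  have "0 \<le> ?f n" for n
    using digit_le_1[of x n] by auto
  then have "?f n = 0" for n
    using suminf_eq_zero_iff[of ?f] sums_summable[OF f] sums_unique[OF f] by simp
  from this[of "i - 1"] have "1 + real (digit y i) - real (digit x i) = 0"
    using \<open>k < i\<close> by (auto split: if_splits)
  then show ?thesis using digit_cases[of i x] digit_cases[of i y] \<open>k < i\<close> by auto
qed

text \<open>From the first difference \<open>k\<close> onwards each term is at most twice the
  geometric one, so the sum is at most \<open>2 / 2 ^ k\<close>, twice the distance.\<close>

lemma abs_binval_diff_le: "\<bar>binval x - binval y\<bar> \<le> 2 * dist x y"
proof -
  have *: "binval v - binval u \<le> 2 * dist u v" if "lex_less u v" for u v
  proof -
    obtain k where k: "1 \<le> k" "digit u k = 0" "digit v k = 1" "\<And>i. i < k \<Longrightarrow> digit u i = digit v i"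
      using \<open>lex_less u v\<close> by (rule lex_lessE) blast
    have "binval v - binval u \<le> 2 * (1 / 2 ^ k)"
    proof (rule sums_le[OF _ binval_diff_sums[OF k] sums_mult[OF geometric_tail_sums]])
      fix n
      have "1 + real (digit v (Suc n)) - real (digit u (Suc n)) \<le> 2"
        using digit_le_1[of v n] by simp
      then show "(if n < k then 0 else (1 + real (digit v (Suc n)) - real (digit u (Suc n))) / 2 ^ Suc n)
          \<le> 2 * (if n < k then 0 else 1 / 2 ^ Suc n)"
        by (simp add: divide_simps)
    qed
    also have "1 / 2 ^ k = dist u v"
      using dist_bitseq_first_difference[of k u v] k by (simp add: power_divide)
    finally show ?thesis .
  qed
  show ?thesis
  proof (cases "x = y")
    case False
    then consider "lex_less x y" | "lex_less y x" using lex_less_linear by blast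
    then show ?thesis
      using *[of x y] *[of y x] lex_less_binval_le[of x y] lex_less_binval_le[of y x]
      by cases (simp_all add: dist_commute)
  qed simp
qed

lemma continuous_on_binval: "continuous_on S binval"
proof (rule lipschitz_on_continuous_on)
  show "2-lipschitz_on S binval"
    by (rule lipschitz_onI) (use abs_binval_diff_le in \<open>auto simp: dist_real_def\<close>)
qed

lemma binval_in_unit: "binval x \<in> {0..1}"
proof -
  have "0 \<le> binval x"
    by (rule sums_le[OF _ sums_zero binval_sums]) simp
  moreover have "binval x \<le> 1"
    by (rule sums_le[OF _ binval_sums power_half_series])
      (use digit_le_1[of x] in \<open>auto simp: power_divide intro!: divide_right_mono\<close>)
  ultimately show ?thesis by simp
qed

text \<open>At the first difference \<open>y\<close> has a one, making the common value positive,
  and \<open>x\<close> has a zero, keeping it below one.\<close>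

lemma binval_pair_interior:
  assumes "lex_less x y" "binval x = binval y"
  shows "0 < binval x" "binval x < 1"
proof -
  obtain k where k: "1 \<le> k" "digit x k = 0" "digit y k = 1"
    using \<open>lex_less x y\<close> by (rule lex_lessE) blast
  have "0 < (\<Sum>n. real (digit y (Suc n)) / 2 ^ Suc n)"
    by (rule suminf_pos2[of _ "k - 1"]) (use k sums_summable[OF binval_sums[of y]] in auto)
  then show "0 < binval x" using assms(2) by (simp add: binval_def)
  have s: "(\<lambda>n. (1 / 2) ^ Suc n - real (digit x (Suc n)) / 2 ^ Suc n) sums (1 - binval x)"
    by (intro sums_diff power_half_series binval_sums)
  have "0 < (\<Sum>n. (1 / 2) ^ Suc n - real (digit x (Suc n)) / 2 ^ Suc n)"
    by (rule suminf_pos2[of _ "k - 1"])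
      (use k digit_le_1[of x] sums_summable[OF s] in \<open>auto simp: power_divide intro!: divide_right_mono\<close>)
  then show "binval x < 1" using sums_unique[OF s] by simp
qed

section \<open>Surjectivity and compactness\<close>

text \<open>A map from the product space of booleans, along which compactness can be pushed forward;
  it is surjective but not injective, as \<open>P 0\<close> is discarded.\<close>

definition bitseq_of :: "(nat \<Rightarrow> bool) \<Rightarrow> bitseq" where
  "bitseq_of P = Abs_bitseq (\<lambda>i\<in>{1..}. if P i then 1 else 0)"

lemma digit_bitseq_of: "1 \<le> i \<Longrightarrow> digit (bitseq_of P) i = (if P i then 1 else 0)"
  unfolding bitseq_of_def by (subst Abs_bitseq_inverse) auto

lemma surj_bitseq_of: "surj bitseq_of"
proof (rule surjI)
  fix x
  show "bitseq_of (\<lambda>i. digit x i = 1) = x"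
    by (rule digit_eqI) (use digit_cases in \<open>auto simp: digit_bitseq_of\<close>)
qed

lemma floor_double: "\<lfloor>2 * a :: real\<rfloor> = 2 * \<lfloor>a\<rfloor> + (if odd \<lfloor>2 * a\<rfloor> then 1 else 0)"
proof -
  have "\<lfloor>2 * a\<rfloor> = 2 * \<lfloor>a\<rfloor> \<or> \<lfloor>2 * a\<rfloor> = 2 * \<lfloor>a\<rfloor> + 1" by linarith
  then show ?thesis by auto
qed

lemma range_binval: "range binval = {0..1}"
proof (intro equalityI subsetI)
  fix s :: real assume "s \<in> {0..1}"
  then consider "s = 1" | "0 \<le> s" "s < 1" by fastforce
  then show "s \<in> range binval"
  proof cases
    case 1
    \<comment> \<open>The value \<open>1\<close> is treated apart: the parity digits used for
      \<open>s < 1\<close> would all be zero there, since \<open>2 ^ n\<close> is even for positive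
      \<open>n\<close>.\<close>
    have "binval (bitseq_of (\<lambda>_. True)) = (\<Sum>n. (1 / 2) ^ Suc n)"
      by (simp add: binval_def digit_bitseq_of power_divide)
    also have "\<dots> = 1" using power_half_series by (rule sums_unique[symmetric])
    finally show ?thesis using 1 by (metis rangeI)
  next
    case 2
    \<comment> \<open>The partial sums of these digits are \<open>s\<close> truncated to
      \<open>n\<close> bits, with error below \<open>1 / 2 ^ n\<close>; the induction starts from
      \<open>\<lfloor>s\<rfloor> = 0\<close>.\<close>
    define x where "x = bitseq_of (\<lambda>n. odd \<lfloor>2 ^ n * s\<rfloor>)"
    have partial: "(\<Sum>i<n. real (digit x (Suc i)) / 2 ^ Suc i) = \<lfloor>2 ^ n * s\<rfloor> / 2 ^ n" for n
    proof (induction n)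
      case 0
      then show ?case using 2 by (simp add: floor_eq_iff)
    next
      case (Suc n)
      have "real_of_int \<lfloor>2 ^ Suc n * s\<rfloor> = 2 * real_of_int \<lfloor>2 ^ n * s\<rfloor> + real (digit x (Suc n))"
        using floor_double[of "2 ^ n * s"] by (auto simp: x_def digit_bitseq_of mult.assoc)
      then show ?case using Suc by (simp add: field_simps)
    qed
    have "(\<lambda>n. \<lfloor>2 ^ n * s\<rfloor> / 2 ^ n) \<longlonglongrightarrow> s"
    proof (rule real_tendsto_sandwich)
      show "\<forall>\<^sub>F n in sequentially. s - (1 / 2) ^ n \<le> \<lfloor>2 ^ n * s\<rfloor> / 2 ^ n"
      proof (intro always_eventually allI)
        fix n
        have "2 ^ n * s - 1 \<le> \<lfloor>2 ^ n * s\<rfloor>" by linarith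
        then have "(2 ^ n * s - 1) / 2 ^ n \<le> \<lfloor>2 ^ n * s\<rfloor> / 2 ^ n"
          by (intro divide_right_mono) simp_all
        then show "s - (1 / 2) ^ n \<le> \<lfloor>2 ^ n * s\<rfloor> / 2 ^ n"
          by (simp add: diff_divide_distrib power_divide)
      qed
      show "\<forall>\<^sub>F n in sequentially. \<lfloor>2 ^ n * s\<rfloor> / 2 ^ n \<le> s"
      proof (intro always_eventually allI)
        fix n
        have "\<lfloor>2 ^ n * s\<rfloor> \<le> 2 ^ n * s" by linarith
        then show "\<lfloor>2 ^ n * s\<rfloor> / 2 ^ n \<le> s" by (simp add: field_simps)
      qed
      have "(\<lambda>n. s - (1 / 2) ^ n) \<longlonglongrightarrow> s - 0"
        by (intro tendsto_intros LIMSEQ_power_zero) simp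
      then show "(\<lambda>n. s - (1 / 2) ^ n) \<longlonglongrightarrow> s" by simp
    qed simp
    then have "(\<lambda>n. real (digit x (Suc n)) / 2 ^ Suc n) sums s"
      unfolding sums_def partial .
    then have "binval x = s" using binval_sums sums_unique2 by blast
    then show ?thesis by blast
  qed
qed (use binval_in_unit in auto)

text \<open>Tychonoff's theorem gives compactness of the product of two-point spaces, and
  \<open>bitseq_of\<close> maps it continuously onto \<Omega>.\<close>

lemma compact_bitseq: "compact (UNIV :: bitseq set)"
proof -
  have "compactin (product_topology (\<lambda>_. euclidean) UNIV) (PiE UNIV (\<lambda>_::nat. UNIV :: bool set))"
    by (subst compactin_PiE) (simp add: finite_imp_compact)
  then have c: "compact (UNIV :: (nat \<Rightarrow> bool) set)"
    by (simp add: euclidean_product_topology)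
  have "continuous_on UNIV bitseq_of"
    unfolding continuous_on_def
  proof (intro ballI tendstoI)
    fix P :: "nat \<Rightarrow> bool" and e :: real assume "0 < e"
    then obtain n where n: "(1 / 2) ^ n < e" using real_arch_pow_inv[of e "1/2"] by auto
    \<comment> \<open>Closeness in \<Omega> concerns only the coordinates up to \<open>n\<close>,
      and each of them is constant near \<open>P\<close> because \<open>bool\<close> is
      discrete.\<close>
    have "\<forall>\<^sub>F Q in at P. \<forall>i\<in>{..n}. Q i = P i"
    proof (intro eventually_ball_finite ballI)
      fix i
      have "((\<lambda>Q. Q i) \<longlongrightarrow> P i) (at P)"
        using continuous_on_product_coordinates[of i] unfolding continuous_on_def by blast
      then show "\<forall>\<^sub>F Q in at P. Q i = P i" by (simp add: tendsto_discrete)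
    qed simp
    then show "\<forall>\<^sub>F Q in at P. dist (bitseq_of Q) (bitseq_of P) < e"
    proof eventually_elim
      case (elim Q)
      have "digit (bitseq_of Q) i = digit (bitseq_of P) i" if "i \<le> n" for i
        using elim that digit_bitseq_of[of i] digit_0 by (cases i) auto
      then have "dist (bitseq_of Q) (bitseq_of P) < (1 / 2) ^ n"
        by (simp add: dist_bitseq_less_iff)
      then show ?case using n by linarith
    qed
  qed
  from compact_continuous_image[OF this c] show ?thesis by (simp add: surj_bitseq_of)
qed

section \<open>Points with two expansions\<close>

text \<open>Beyond \<open>k\<close> the sequence \<open>y\<close> is zero, so a nearby
  \<open>z\<close> first departs from it by a one and is lexicographically larger. Equal values
  would force ones in \<open>y\<close> after that departure.\<close>

lemma near_upper_expansion:
  assumes "lex_less x y" "binval x = binval y"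
  shows "\<forall>\<^sub>F z in nhds y. z = y \<or> binval y < binval z"
proof -
  obtain k where k: "1 \<le> k" "digit x k = 0" "digit y k = 1" "\<And>i. i < k \<Longrightarrow> digit x i = digit y i"
    using \<open>lex_less x y\<close> by (rule lex_lessE) blast
  have y0: "digit y i = 0" if "k < i" for i
    using binval_eq_tails[OF k assms(2) that] by simp
  have "z = y \<or> binval y < binval z" if "dist z y < (1 / 2) ^ k" for z
  proof (rule disjCI)
    assume "\<not> binval y < binval z"
    show "z = y"
    proof (rule ccontr)
      assume "z \<noteq> y"
      then obtain j where j: "1 \<le> j" "digit y j \<noteq> digit z j" "\<And>i. i < j \<Longrightarrow> digit y i = digit z i"
        using first_difference[of y z] by metis
      have "k < j" using that j(2) unfolding dist_bitseq_less_iff by (metis not_le)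
      then have d: "digit y j = 0" "digit z j = 1"
        using y0 j digit_cases[of j z] by auto
      then have "lex_less y z" by (intro lex_lessI[of y j z] j(3)) simp
      then have "binval y = binval z"
        using lex_less_binval_le \<open>\<not> binval y < binval z\<close> by fastforce
      then have "digit y (Suc j) = 1"
        using binval_eq_tails[OF j(1) d j(3)] by simp
      with y0 \<open>k < j\<close> show False by simp
    qed
  qed
  then show ?thesis unfolding eventually_nhds_metric
    by (intro exI[of _ "(1 / 2) ^ k"]) simp
qed

text \<open>The mirror image: \<open>x\<close> ends in ones, a nearby \<open>z\<close> departs by a
  zero, and equal values would force zeros in \<open>x\<close> afterwards.\<close>

lemma near_lower_expansion:
  assumes "lex_less x y" "binval x = binval y"
  shows "\<forall>\<^sub>F z in nhds x. z = x \<or> binval z < binval x"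
proof -
  obtain k where k: "1 \<le> k" "digit x k = 0" "digit y k = 1" "\<And>i. i < k \<Longrightarrow> digit x i = digit y i"
    using \<open>lex_less x y\<close> by (rule lex_lessE) blast
  have x1: "digit x i = 1" if "k < i" for i
    using binval_eq_tails[OF k assms(2) that] by simp
  have "z = x \<or> binval z < binval x" if "dist z x < (1 / 2) ^ k" for z
  proof (rule disjCI)
    assume "\<not> binval z < binval x"
    show "z = x"
    proof (rule ccontr)
      assume "z \<noteq> x"
      then obtain j where j: "1 \<le> j" "digit z j \<noteq> digit x j" "\<And>i. i < j \<Longrightarrow> digit z i = digit x i"
        by (rule first_difference) blast
      have "k < j" using that j(2) unfolding dist_bitseq_less_iff by (metis not_le)
      then have d: "digit z j = 0" "digit x j = 1"
        using x1 j digit_cases[of j z] by auto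
      then have "lex_less z x" by (intro lex_lessI[of z j x] j(3)) simp
      then have "binval z = binval x"
        using lex_less_binval_le \<open>\<not> binval z < binval x\<close> by fastforce
      then have "digit x (Suc j) = 0"
        using binval_eq_tails[OF j(1) d j(3)] by simp
      with x1 \<open>k < j\<close> show False by simp
    qed
  qed
  then show ?thesis unfolding eventually_nhds_metric
    by (intro exI[of _ "(1 / 2) ^ k"]) simp
qed

lemma lex_less_antisym: "lex_less x y \<Longrightarrow> \<not> lex_less y x"
  unfolding lex_less_def by (rule less_fun_asym)

text \<open>In a lexicographic chain of three expansions the middle one would end both in zeros and
  in ones.\<close>

lemma binval_fibre_pair:
  assumes "lex_less x y" "binval x = binval y" "binval z = binval x"
  shows "z = x \<or> z = y"
proof -
  have tails: "\<exists>k. \<forall>i>k. digit u i = 1 \<and> digit v i = 0" if "lex_less u v" "binval u = binval v" for u v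
  proof -
    obtain k where k: "1 \<le> k" "digit u k = 0" "digit v k = 1" "\<And>i. i < k \<Longrightarrow> digit u i = digit v i"
      using \<open>lex_less u v\<close> by (rule lex_lessE) blast
    show ?thesis using binval_eq_tails[OF k that(2)] by blast
  qed
  have no_chain: False
    if uv: "lex_less u v" "binval u = binval v" and vw: "lex_less v w" "binval v = binval w" for u v w
  proof -
    obtain k where "\<forall>i>k. digit v i = 0"
      using tails[OF uv] by blast
    moreover obtain l where "\<forall>i>l. digit v i = 1"
      using tails[OF vw] by blast
    ultimately have "digit v (Suc (k + l)) = 0 \<and> digit v (Suc (k + l)) = 1"
      by (metis add_Suc less_add_Suc1 less_add_Suc2)
    then show False by auto
  qed
  show ?thesis
    using no_chain[of x y z] no_chain[of x z y] no_chain[of z x y] assms lex_less_linear by metis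
qed

lemma two_expansionsE:
  assumes "s \<in> two_expansions"
  obtains x y where "lex_less x y" "binval x = s" "binval y = s"
proof -
  from assms have "card (binval -` {s}) = 2" by (simp add: two_expansions_def)
  then obtain x y where "binval -` {s} = {x, y}" "x \<noteq> y" by (auto simp: card_2_iff)
  then have "binval x = s" "binval y = s" "x \<noteq> y" by auto
  with lex_less_linear that show ?thesis by metis
qed

text \<open>\<open>binval_fibre_pair\<close> excludes a third expansion, so a single pair settles
  the cardinality of the fibre.\<close>

lemma two_expansionsI:
  assumes "lex_less x y" "binval x = binval y"
  shows "binval x \<in> two_expansions"
proof -
  have "x \<noteq> y" using lex_less_antisym assms(1) by blast
  moreover have "binval -` {binval x} = {x, y}"
    using binval_fibre_pair[OF assms] assms(2) by auto
  ultimately show ?thesis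
    using binval_in_unit by (simp add: two_expansions_def)
qed

lemma binval_inj_outside:
  assumes "binval x \<notin> two_expansions" "binval z = binval x"
  shows "z = x"
  using assms two_expansionsI[of x z] two_expansionsI[of z x] lex_less_linear by metis

text \<open>The complement of \<open>U\<close> is compact, so its image is closed, and that image
  misses \<open>s\<close>.\<close>

lemma binval_tube:
  assumes "open U" "binval -` {s} \<subseteq> U"
  shows "\<forall>\<^sub>F t in nhds s. \<forall>z. binval z = t \<longrightarrow> z \<in> U"
proof -
  have "compact (- U)"
    using compact_Int_closed[OF compact_bitseq, of "- U"] assms(1) by (simp add: closed_Compl)
  then have "closed (binval ` (- U))"
    by (intro compact_imp_closed compact_continuous_image continuous_on_binval)
  moreover have "s \<in> - binval ` (- U)" using assms(2) by auto
  ultimately show ?thesis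
    unfolding eventually_nhds by (intro exI[of _ "- binval ` (- U)"]) auto
qed

text \<open>The cases match the branches of \<open>Theta\<close>: evaluation, left limit and right
  limit.\<close>

lemma expansion_cases:
  obtains (unique) "binval x \<notin> two_expansions"
  | (lower) y where "lex_less x y" "binval x = binval y"
  | (upper) w where "lex_less w x" "binval w = binval x"
proof (cases "binval x \<in> two_expansions")
  case True
  then obtain u v where "lex_less u v" "binval u = binval x" "binval v = binval x"
    by (rule two_expansionsE) blast
  then show ?thesis using binval_fibre_pair[of u v x] lower upper by metis
qed (use unique in blast)

lemma two_expansions_interior:
  assumes "s \<in> two_expansions"
  shows "0 < s" "s < 1"
  using assms binval_pair_interior by (metis two_expansionsE)+

section \<open>One-sided filters at points with two expansions\<close>

lemma at_within_lower: "0 < s \<Longrightarrow> at s within {0..<s} = at_left (s :: real)"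
  by (rule at_within_nhd[of _ "{0<..}"]) auto

lemma at_within_upper: "s < 1 \<Longrightarrow> at s within {s<..1} = at_right (s :: real)"
  by (rule at_within_nhd[of _ "{..<1}"]) auto

text \<open>\<open>Lim\<close> is determined only along a nontrivial filter. Points with two
  expansions are interior, so the filter is the ordinary left one.\<close>

lemma at_within_lower_nontrivial: "s \<in> two_expansions \<Longrightarrow> at s within {0..<s} \<noteq> bot"
  using two_expansions_interior by (simp add: at_within_lower)

lemma at_within_upper_nontrivial: "s \<in> two_expansions \<Longrightarrow> at s within {s<..1} \<noteq> bot"
  using two_expansions_interior by (simp add: at_within_upper)

lemma Theta_unique: "binval x \<notin> two_expansions \<Longrightarrow> Theta F x = F (binval x)"
  by (simp add: Theta_def)

section \<open>Continuity of the image\<close>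

lemma D01_vanish: "F \<in> D01 \<Longrightarrow> s \<notin> {0..1} \<Longrightarrow> F s = 0"
  unfolding D01_def by (drule CollectD) (elim conjE, drule spec, erule mp)

lemma D01_continuous:
  "F \<in> D01 \<Longrightarrow> s \<in> {0..1} - two_expansions \<Longrightarrow> continuous (at s within {0..1}) F"
  unfolding D01_def by (drule CollectD) (elim conjE, drule bspec)

lemma D01_limits:
  assumes "F \<in> D01" "s \<in> two_expansions"
  obtains l where "(F \<longlongrightarrow> l) (at s within {0..<s})" "(F \<longlongrightarrow> F s) (at s within {s<..1})"
proof -
  have "\<forall>s\<in>two_expansions.
      (\<exists>l. (F \<longlongrightarrow> l) (at s within {0..<s})) \<and> (F \<longlongrightarrow> F s) (at s within {s<..1})"
    using assms(1) unfolding D01_def by (elim CollectE conjE)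
  from bspec[OF this assms(2)] that show ?thesis by (elim conjE exE)
qed

lemma D01I:
  assumes "\<And>s. s \<notin> {0..1} \<Longrightarrow> F s = 0"
    and "\<And>s. s \<in> {0..1} - two_expansions \<Longrightarrow> continuous (at s within {0..1}) F"
    and "\<And>s. s \<in> two_expansions \<Longrightarrow> \<exists>l. (F \<longlongrightarrow> l) (at s within {0..<s})"
    and "\<And>s. s \<in> two_expansions \<Longrightarrow> (F \<longlongrightarrow> F s) (at s within {s<..1})"
  shows "F \<in> D01"
  unfolding D01_def by (intro CollectI conjI allI impI ballI assms)

text \<open>The left limit exists by membership in \<open>D01\<close>, and nontriviality of the
  filter makes \<open>Lim\<close> equal to it.\<close>

lemma Theta_lower:
  assumes "F \<in> D01" "lex_less x y" "binval x = binval y"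
  shows "(F \<longlongrightarrow> Theta F x) (at (binval x) within {0..<binval x})"
proof -
  have D: "binval x \<in> two_expansions" using assms by (intro two_expansionsI)
  then obtain l where l: "(F \<longlongrightarrow> l) (at (binval x) within {0..<binval x})"
    using D01_limits[OF assms(1)] by blast
  have "Theta F x = Lim (at (binval x) within {0..<binval x}) F"
    using D assms(2,3) unfolding Theta_def by metis
  also have "\<dots> = l" by (rule tendsto_Lim[OF at_within_lower_nontrivial[OF D] l])
  finally show ?thesis using l by simp
qed

lemma upper_expansion_maximal:
  assumes "lex_less x y" "binval x = binval y"
  shows "\<not> (\<exists>z. binval z = binval y \<and> lex_less y z)"
  using assms binval_fibre_pair lex_less_antisym by metis

text \<open>Right continuity at points with two expansions turns the right limit into a value of
  \<open>F\<close>.\<close>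

lemma Theta_upper:
  assumes "F \<in> D01" "lex_less x y" "binval x = binval y"
  shows "Theta F y = F (binval y)"
proof -
  have D: "binval y \<in> two_expansions" using assms two_expansionsI by metis
  have "Theta F y = Lim (at (binval y) within {binval y<..1}) F"
    using D upper_expansion_maximal[OF assms(2,3)] by (auto simp: Theta_def)
  also have "\<dots> = F (binval y)"
    by (rule tendsto_Lim[OF at_within_upper_nontrivial[OF D]])
      (use D assms(1) in \<open>simp add: D01_def\<close>)
  finally show ?thesis .
qed

text \<open>\<open>Theta F x\<close> is either \<open>F (binval x)\<close> or a left limit there.
  Closed bounds on \<open>F\<close> near \<open>binval x\<close> thus pass to \<open>Theta F\<close>
  whatever the kind of the expansion.\<close>

lemma Theta_in_closure:
  assumes "F \<in> D01" "open U" "binval x \<in> U"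
  shows "Theta F x \<in> closure (F ` (U \<inter> {0..1}))"
proof -
  have val: "F (binval x) \<in> closure (F ` (U \<inter> {0..1}))"
    using assms(3) binval_in_unit[of x] by (intro subsetD[OF closure_subset] imageI IntI)
  show ?thesis
  proof (cases x rule: expansion_cases)
    case unique
    then show ?thesis using val by (simp add: Theta_unique)
  next
    case (lower y)
    have "\<forall>\<^sub>F t in nhds (binval x). t \<in> U"
      using assms(2,3) by (rule eventually_nhds_in_open)
    then have "\<forall>\<^sub>F t in at (binval x) within {0..<binval x}. t \<in> U \<inter> {0..1}"
      unfolding eventually_at_filter using binval_in_unit[of x] by (auto elim!: eventually_mono)
    then have "\<forall>\<^sub>F t in at (binval x) within {0..<binval x}. F t \<in> closure (F ` (U \<inter> {0..1}))"
      by eventually_elim (intro subsetD[OF closure_subset] imageI)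
    then show ?thesis
      by (rule Lim_in_closed_set[OF closed_closure _ _ Theta_lower[OF assms(1) lower]])
        (rule at_within_lower_nontrivial[OF two_expansionsI[OF lower]])
  next
    case (upper w)
    then show ?thesis using val Theta_upper[OF assms(1) upper] by simp
  qed
qed

text \<open>The part of the continuity proof common to all kinds of \<open>x\<close>:
  \<open>W\<close> contains the values of nearby sequences other than \<open>x\<close>, and
  \<open>T\<close> is the set along which \<open>F\<close> has the right limit.\<close>

lemma isCont_Theta_aux:
  assumes "F \<in> D01" and lim: "(F \<longlongrightarrow> Theta F x) (at (binval x) within T)"
    and "open W" and near: "\<forall>\<^sub>F z in nhds x. z = x \<or> binval z \<in> W"
    and W: "W \<inter> {0..1} - {binval x} \<subseteq> T" "binval x \<in> W \<Longrightarrow> F (binval x) = Theta F x"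
  shows "isCont (Theta F) x"
  unfolding isCont_def
proof (rule tendstoI)
  fix e :: real assume "0 < e"
  with tendstoD[OF lim, of "e / 2"]
  obtain U where U: "open U" "binval x \<in> U"
    "\<And>t. t \<in> U \<Longrightarrow> t \<noteq> binval x \<Longrightarrow> t \<in> T \<Longrightarrow> dist (F t) (Theta F x) < e / 2"
    unfolding eventually_at_topological by auto
  \<comment> \<open>Passing to the closure keeps only non-strict bounds; the radius
    \<open>e / 2\<close> restores strictness at the end.\<close>
  have sub: "closure (F ` (U \<inter> W \<inter> {0..1})) \<subseteq> cball (Theta F x) (e / 2)"
  proof (rule closure_minimal)
    show "F ` (U \<inter> W \<inter> {0..1}) \<subseteq> cball (Theta F x) (e / 2)"
    proof (rule image_subsetI)
      fix t assume t: "t \<in> U \<inter> W \<inter> {0..1}"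
      show "F t \<in> cball (Theta F x) (e / 2)"
      proof (cases "t = binval x")
        case True
        then show ?thesis using W(2) t \<open>0 < e\<close> by simp
      next
        case False
        then have "dist (F t) (Theta F x) < e / 2" using U(3) W(1) t by blast
        then show ?thesis by (simp add: dist_commute)
      qed
    qed
  qed simp
  have "\<forall>\<^sub>F z in nhds x. binval z \<in> U"
    using eventually_nhds_in_open[of "binval -` U" x] U(1,2)
      continuous_on_open_vimage[of UNIV binval] continuous_on_binval by auto
  with near have "\<forall>\<^sub>F z in nhds x. dist (Theta F z) (Theta F x) < e"
  proof eventually_elim
    case (elim z)
    show ?case
    proof (cases "z = x")
      case False
      then have "Theta F z \<in> closure (F ` (U \<inter> W \<inter> {0..1}))"
        using elim Theta_in_closure[OF assms(1), of "U \<inter> W" z] U(1) \<open>open W\<close> by auto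
      then have "Theta F z \<in> cball (Theta F x) (e / 2)" using sub by blast
      then show ?thesis using \<open>0 < e\<close> by (simp add: dist_commute)
    qed (use \<open>0 < e\<close> in simp)
  qed
  then show "\<forall>\<^sub>F z in at x. dist (Theta F z) (Theta F x) < e"
    by (simp add: eventually_at_filter eventually_mono)
qed

lemma continuous_Theta:
  assumes "F \<in> D01"
  shows "continuous_on UNIV (Theta F)"
proof -
  have "isCont (Theta F) x" for x
  proof (cases x rule: expansion_cases)
    case unique
    then have "(F \<longlongrightarrow> Theta F x) (at (binval x) within {0..1})"
      using assms binval_in_unit[of x] by (auto simp: D01_def Theta_unique continuous_within)
    then show ?thesis
      by (rule isCont_Theta_aux[OF assms, where W = UNIV]) (use unique in \<open>auto simp: Theta_unique\<close>)
  next
    case (lower y)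
    \<comment> \<open>The open half-line below \<open>binval x\<close> leaves only the left limit
      and makes the condition at \<open>binval x\<close> itself vacuous.\<close>
    show ?thesis
      by (rule isCont_Theta_aux[OF assms Theta_lower[OF assms lower], where W = "{..<binval x}"])
        (use near_lower_expansion[OF lower] in auto)
  next
    case (upper w)
    then have "(F \<longlongrightarrow> Theta F x) (at (binval x) within {binval x<..1})"
      using assms two_expansionsI[OF upper] by (simp add: D01_def Theta_upper[OF assms upper])
    then show ?thesis
      by (rule isCont_Theta_aux[OF assms, where W = "{binval x<..}"])
        (use near_upper_expansion[OF upper] in auto)
  qed
  then show ?thesis by (simp add: continuous_on_eq_continuous_at)
qed

section \<open>The inverse\<close>

text \<open>The greatest expansion is chosen because functions in \<open>D01\<close> are right
  continuous at points with two expansions; the value \<open>0\<close> outside \<open>{0..1}\<close>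
  follows the convention of \<open>D01\<close>.\<close>

definition Theta_inv :: "(bitseq \<Rightarrow> real) \<Rightarrow> real \<Rightarrow> real" where
  "Theta_inv f s = (if s \<in> {0..1}
     then f (SOME x. binval x = s \<and> \<not> (\<exists>y. binval y = s \<and> lex_less x y)) else 0)"

text \<open>The order is linear, so a fibre has at most one maximal element and \<open>SOME\<close>
  must select \<open>x\<close>.\<close>

lemma Theta_inv_maximal:
  assumes "\<not> (\<exists>y. binval y = binval x \<and> lex_less x y)"
  shows "Theta_inv f (binval x) = f x"
proof -
  have "(SOME z. binval z = binval x \<and> \<not> (\<exists>y. binval y = binval x \<and> lex_less z y)) = x"
    by (rule some_equality) (use assms lex_less_linear in blast)+
  then show ?thesis using binval_in_unit by (simp add: Theta_inv_def)
qed

lemma Theta_inv_unique: "binval x \<notin> two_expansions \<Longrightarrow> Theta_inv f (binval x) = f x"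
  by (rule Theta_inv_maximal) (metis two_expansionsI)

lemma Theta_inv_upper:
  assumes "lex_less x y" "binval x = binval y"
  shows "Theta_inv f (binval y) = f y"
  by (rule Theta_inv_maximal[OF upper_expansion_maximal[OF assms]])

text \<open>Hides which expansion is chosen, so that statements about all expansions of
  \<open>s\<close> apply to \<open>Theta_inv f s\<close>.\<close>

lemma Theta_inv_value:
  assumes "s \<in> {0..1}"
  obtains x where "binval x = s" "Theta_inv f s = f x"
proof (cases "s \<in> two_expansions")
  case True
  then show ?thesis using that Theta_inv_upper by (metis two_expansionsE)
next
  case False
  obtain x where "s = binval x" using assms range_binval by (metis imageE)
  then show ?thesis using that False Theta_inv_unique by blast
qed

text \<open>By \<open>far\<close>, the other expansions of \<open>binval x\<close> have
  neighbourhoods whose values avoid \<open>T\<close>. By \<open>binval_tube\<close>, every expansion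
  of a nearby point of \<open>T\<close> then lies where \<open>f\<close> is close to
  \<open>f x\<close>.\<close>

lemma Theta_inv_tendsto:
  assumes "continuous_on UNIV f" "T \<subseteq> {0..1}"
    and far: "\<And>y. y \<noteq> x \<Longrightarrow> binval y = binval x \<Longrightarrow> \<forall>\<^sub>F z in nhds y. binval z \<notin> T"
  shows "(Theta_inv f \<longlongrightarrow> f x) (at (binval x) within T)"
proof (rule tendstoI)
  fix e :: real assume "0 < e"
  define A where "A = f -` ball (f x) e"
  \<comment> \<open>The largest open set of sequences with values outside \<open>T\<close>; by
    \<open>far\<close> it contains every other expansion of \<open>binval x\<close>.\<close>
  define V where "V = \<Union>{V. open V \<and> (\<forall>z\<in>V. binval z \<notin> T)}"
  have "open A" unfolding A_def
    using assms(1) continuous_on_open_vimage[of UNIV f] by (metis Int_UNIV_right open_UNIV open_ball)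
  moreover have "open V" unfolding V_def by (intro open_Union) auto
  moreover have "binval -` {binval x} \<subseteq> A \<union> V"
  proof
    fix y assume "y \<in> binval -` {binval x}"
    show "y \<in> A \<union> V"
    proof (cases "y = x")
      case True
      then show ?thesis using \<open>0 < e\<close> by (simp add: A_def)
    next
      case False
      with \<open>y \<in> _\<close> have "\<forall>\<^sub>F z in nhds y. binval z \<notin> T" by (intro far) auto
      then show ?thesis unfolding V_def eventually_nhds by blast
    qed
  qed
  ultimately have "\<forall>\<^sub>F t in nhds (binval x). \<forall>z. binval z = t \<longrightarrow> z \<in> A \<union> V"
    by (intro binval_tube open_Un)
  then have "\<forall>\<^sub>F t in at (binval x) within T. \<forall>z. binval z = t \<longrightarrow> z \<in> A \<union> V"
    by (simp add: eventually_at_filter eventually_mono)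
  moreover have "\<forall>\<^sub>F t in at (binval x) within T. t \<in> T"
    by (simp add: eventually_at_filter)
  ultimately show "\<forall>\<^sub>F t in at (binval x) within T. dist (Theta_inv f t) (f x) < e"
  proof eventually_elim
    case (elim t)
    obtain z where z: "binval z = t" "Theta_inv f t = f z"
      using Theta_inv_value elim(2) assms(2) by blast
    then have "z \<notin> V" using elim(2) by (auto simp: V_def)
    then have "z \<in> A" using elim(1) z(1) by blast
    then show ?case using z(2) by (simp add: A_def dist_commute)
  qed
qed

lemma Theta_inv_tendsto_lower:
  assumes "continuous_on UNIV f" "lex_less x y" "binval x = binval y"
  shows "(Theta_inv f \<longlongrightarrow> f x) (at (binval x) within {0..<binval x})"
proof (rule Theta_inv_tendsto[OF assms(1)])
  show "{0..<binval x} \<subseteq> {0..1}" using binval_in_unit[of x] by auto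
  fix z assume "z \<noteq> x" "binval z = binval x"
  then have "z = y" using binval_fibre_pair[OF assms(2,3)] by blast
  then show "\<forall>\<^sub>F z in nhds z. binval z \<notin> {0..<binval x}"
    using near_upper_expansion[OF assms(2,3)] by (auto elim!: eventually_mono simp: assms(3))
qed

lemma Theta_inv_tendsto_upper:
  assumes "continuous_on UNIV f" "lex_less x y" "binval x = binval y"
  shows "(Theta_inv f \<longlongrightarrow> f y) (at (binval y) within {binval y<..1})"
proof (rule Theta_inv_tendsto[OF assms(1)])
  show "{binval y<..1} \<subseteq> {0..1}" using binval_in_unit[of y] by auto
  fix z assume "z \<noteq> y" "binval z = binval y"
  then have "z = x" using binval_fibre_pair[OF assms(2,3)] assms(3) by metis
  then show "\<forall>\<^sub>F z in nhds z. binval z \<notin> {binval y<..1}"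
    using near_lower_expansion[OF assms(2,3)] by (auto elim!: eventually_mono simp: assms(3))
qed

lemma Theta_inv_in_D01:
  assumes "continuous_on UNIV f"
  shows "Theta_inv f \<in> D01"
proof -
  have "continuous (at s within {0..1}) (Theta_inv f)" if "s \<in> {0..1} - two_expansions" for s
  proof -
    obtain x where x: "binval x = s" using \<open>s \<in> _\<close> range_binval by (metis DiffD1 imageE)
    \<comment> \<open>There is only one expansion here, so the condition \<open>far\<close> is
      vacuous.\<close>
    have "(Theta_inv f \<longlongrightarrow> f x) (at (binval x) within {0..1})"
      by (rule Theta_inv_tendsto[OF assms]) (use x that binval_inj_outside in blast)+
    then show ?thesis
      using x that Theta_inv_unique[of x f] by (simp add: continuous_within)
  qed
  moreover have "(\<exists>l. (Theta_inv f \<longlongrightarrow> l) (at s within {0..<s})) \<and>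
      (Theta_inv f \<longlongrightarrow> Theta_inv f s) (at s within {s<..1})" if "s \<in> two_expansions" for s
  proof -
    obtain x y where xy: "lex_less x y" "binval x = s" "binval y = s"
      using \<open>s \<in> _\<close> by (rule two_expansionsE) blast
    then show ?thesis
      using Theta_inv_tendsto_lower[OF assms xy(1)] Theta_inv_tendsto_upper[OF assms xy(1)]
        Theta_inv_upper[OF xy(1), of f] by auto
  qed
  ultimately show ?thesis by (auto simp: D01_def Theta_inv_def)
qed

lemma Theta_Theta_inv:
  assumes "continuous_on UNIV f"
  shows "Theta (Theta_inv f) = f"
proof
  fix x
  have D: "Theta_inv f \<in> D01" using assms by (rule Theta_inv_in_D01)
  show "Theta (Theta_inv f) x = f x"
  proof (cases x rule: expansion_cases)
    case unique
    then show ?thesis by (simp add: Theta_unique Theta_inv_unique)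
  next
    case (lower y)
    \<comment> \<open>Both sides are the left limit of \<open>Theta_inv f\<close> at
      \<open>binval x\<close>.\<close>
    show ?thesis
      using at_within_lower_nontrivial[OF two_expansionsI[OF lower]]
        Theta_lower[OF D lower] Theta_inv_tendsto_lower[OF assms lower] by (rule tendsto_unique)
  next
    case (upper w)
    then show ?thesis using Theta_upper[OF D upper] Theta_inv_upper[OF upper] by simp
  qed
qed

lemma Theta_inv_Theta:
  assumes "F \<in> D01"
  shows "Theta_inv (Theta F) = F"
proof
  fix s
  consider "s \<notin> {0..1}" | "s \<in> two_expansions" | "s \<in> {0..1} - two_expansions" by blast
  then show "Theta_inv (Theta F) s = F s"
  proof cases
    case 1
    \<comment> \<open>The normalisation in \<open>D01\<close> makes the two functions equal on all
      reals and not only on the unit interval.\<close>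
    then have "F s = 0" using assms unfolding D01_def by blast
    with 1 show ?thesis by (simp only: Theta_inv_def if_False)
  next
    case 2
    then obtain x y where "lex_less x y" "binval x = s" "binval y = s"
      by (rule two_expansionsE) blast
    then show ?thesis using Theta_inv_upper[of x y] Theta_upper[OF assms, of x y] by simp
  next
    case 3
    then obtain x where "binval x = s" using range_binval by (metis DiffD1 imageE)
    then show ?thesis using 3 by (metis DiffD2 Theta_inv_unique Theta_unique)
  qed
qed

lemma bij_betw_Theta: "bij_betw Theta D01 C_Omega"
  by (rule bij_betw_byWitness[where f' = Theta_inv])
    (auto simp: Theta_inv_Theta Theta_Theta_inv C_Omega_def continuous_Theta Theta_inv_in_D01)

section \<open>Linearity, isometry and completeness\<close>

lemma D01_add:
  assumes "F \<in> D01" "G \<in> D01"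
  shows "(\<lambda>s. F s + G s) \<in> D01"
proof (rule D01I)
  fix s assume "s \<in> two_expansions"
  obtain a where a: "(F \<longlongrightarrow> a) (at s within {0..<s})" "(F \<longlongrightarrow> F s) (at s within {s<..1})"
    by (rule D01_limits[OF assms(1) \<open>s \<in> _\<close>])
  obtain b where b: "(G \<longlongrightarrow> b) (at s within {0..<s})" "(G \<longlongrightarrow> G s) (at s within {s<..1})"
    by (rule D01_limits[OF assms(2) \<open>s \<in> _\<close>])
  show "\<exists>l. ((\<lambda>s. F s + G s) \<longlongrightarrow> l) (at s within {0..<s})"
    using tendsto_add[OF a(1) b(1)] by (rule exI)
  show "((\<lambda>s. F s + G s) \<longlongrightarrow> F s + G s) (at s within {s<..1})"
    using a(2) b(2) by (rule tendsto_add)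
next
  show "F s + G s = 0" if "s \<notin> {0..1}" for s
    using D01_vanish[OF assms(1) that] D01_vanish[OF assms(2) that] by simp
  show "continuous (at s within {0..1}) (\<lambda>s. F s + G s)" if "s \<in> {0..1} - two_expansions" for s
    by (intro continuous_add D01_continuous assms that)
qed

lemma D01_scale:
  assumes "F \<in> D01"
  shows "(\<lambda>s. c * F s) \<in> D01"
proof (rule D01I)
  fix s assume "s \<in> two_expansions"
  obtain a where a: "(F \<longlongrightarrow> a) (at s within {0..<s})" "(F \<longlongrightarrow> F s) (at s within {s<..1})"
    by (rule D01_limits[OF assms \<open>s \<in> _\<close>])
  show "\<exists>l. ((\<lambda>s. c * F s) \<longlongrightarrow> l) (at s within {0..<s})"
    using tendsto_mult_left[OF a(1)] by (rule exI)
  show "((\<lambda>s. c * F s) \<longlongrightarrow> c * F s) (at s within {s<..1})"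
    using a(2) by (rule tendsto_mult_left)
next
  show "c * F s = 0" if "s \<notin> {0..1}" for s
    using D01_vanish[OF assms that] by simp
  show "continuous (at s within {0..1}) (\<lambda>s. c * F s)" if "s \<in> {0..1} - two_expansions" for s
    by (intro continuous_mult_left D01_continuous assms that)
qed

text \<open>At a lower expansion both sides are limits of the sum along the same filter; at the
  others \<open>Theta\<close> is evaluation.\<close>

lemma Theta_add:
  assumes "F \<in> D01" "G \<in> D01"
  shows "Theta (\<lambda>s. F s + G s) = (\<lambda>x. Theta F x + Theta G x)"
proof
  fix x
  note D = D01_add[OF assms]
  show "Theta (\<lambda>s. F s + G s) x = Theta F x + Theta G x"
  proof (cases x rule: expansion_cases)
    case (lower y)
    show ?thesis
      using at_within_lower_nontrivial[OF two_expansionsI[OF lower]] Theta_lower[OF D lower]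
        tendsto_add[OF Theta_lower[OF assms(1) lower] Theta_lower[OF assms(2) lower]]
      by (rule tendsto_unique)
  qed (simp_all add: Theta_unique Theta_upper[OF D] Theta_upper[OF assms(1)] Theta_upper[OF assms(2)])
qed

lemma Theta_scale:
  assumes "F \<in> D01"
  shows "Theta (\<lambda>s. c * F s) = (\<lambda>x. c * Theta F x)"
proof
  fix x
  note D = D01_scale[OF assms]
  show "Theta (\<lambda>s. c * F s) x = c * Theta F x"
  proof (cases x rule: expansion_cases)
    case (lower y)
    show ?thesis
      using at_within_lower_nontrivial[OF two_expansionsI[OF lower]] Theta_lower[OF D lower]
        tendsto_mult_left[OF Theta_lower[OF assms lower]]
      by (rule tendsto_unique)
  qed (simp_all add: Theta_unique Theta_upper[OF D] Theta_upper[OF assms])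
qed

text \<open>The inverse formula writes \<open>F s\<close> as a value of \<open>Theta F\<close>.
  Compactness of \<Omega> thereby bounds every function in \<open>D01\<close>.\<close>

lemma D01_image_subset:
  assumes "F \<in> D01"
  shows "F ` {0..1} \<subseteq> range (Theta F)"
proof (rule image_subsetI)
  fix s :: real assume "s \<in> {0..1}"
  then obtain x where "Theta_inv (Theta F) s = Theta F x" using Theta_inv_value by metis
  then show "F s \<in> range (Theta F)" by (simp add: Theta_inv_Theta[OF assms])
qed

lemma bounded_continuous_bitseq: "continuous_on UNIV (f :: bitseq \<Rightarrow> real) \<Longrightarrow> bounded (range f)"
  by (intro compact_imp_bounded compact_continuous_image compact_bitseq)

lemma bounded_D01: "F \<in> D01 \<Longrightarrow> bounded (F ` {0..1})"
  by (rule bounded_subset[OF bounded_continuous_bitseq[OF continuous_Theta] D01_image_subset])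

lemma sup_norm_on_upper:
  assumes "bounded (f ` S)" "x \<in> S"
  shows "\<bar>f x\<bar> \<le> sup_norm_on S f"
  unfolding sup_norm_on_def
  by (rule cSUP_upper[OF assms(2)]) (use assms(1) in \<open>auto simp: bounded_iff bdd_above_def\<close>)

lemma sup_norm_on_Theta:
  assumes "F \<in> D01"
  shows "sup_norm_on UNIV (Theta F) = sup_norm_on {0..1} F"
proof (rule antisym)
  \<comment> \<open>A symmetric interval is closed, so it contains the closure of the values of
    \<open>F\<close>, and with it the values of \<open>Theta F\<close>.\<close>
  have "F ` {0..1} \<subseteq> {- sup_norm_on {0..1} F..sup_norm_on {0..1} F}"
    using sup_norm_on_upper[OF bounded_D01[OF assms]]
    by (intro image_subsetI) (simp add: abs_le_iff minus_le_iff)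
  then have "closure (F ` {0..1}) \<subseteq> {- sup_norm_on {0..1} F..sup_norm_on {0..1} F}"
    by (rule closure_minimal) simp
  then have "Theta F x \<in> {- sup_norm_on {0..1} F..sup_norm_on {0..1} F}" for x
    using Theta_in_closure[OF assms open_UNIV, of x] by auto
  then have "\<bar>Theta F x\<bar> \<le> sup_norm_on {0..1} F" for x
    by (simp add: abs_le_iff minus_le_iff)
  then show "sup_norm_on UNIV (Theta F) \<le> sup_norm_on {0..1} F"
    unfolding sup_norm_on_def[of UNIV] by (intro cSUP_least) auto
  have "\<bar>F s\<bar> \<le> sup_norm_on UNIV (Theta F)" if s: "s \<in> {0..1}" for s
  proof -
    obtain x where "F s = Theta F x"
      using subsetD[OF D01_image_subset[OF assms] imageI[OF s]] by (rule rangeE)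
    then show ?thesis
      using sup_norm_on_upper[OF bounded_continuous_bitseq[OF continuous_Theta[OF assms]]] by simp
  qed
  then show "sup_norm_on {0..1} F \<le> sup_norm_on UNIV (Theta F)"
    unfolding sup_norm_on_def[of "{0..1}"] by (intro cSUP_least) auto
qed

section \<open>Banach space axioms and completeness\<close>

lemma sup_norm_on_bcontfun: "sup_norm_on UNIV (apply_bcontfun f) = norm f"
  by (simp add: sup_norm_on_def norm_bcontfun_def dist_bcontfun.rep_eq)

text \<open>The type of bounded continuous functions is a Banach space; each axiom is read off there
  after writing functions as \<open>apply_bcontfun\<close> of its elements.\<close>

lemma sup_norm_banach_bcontfun:
  "sup_norm_banach UNIV (bcontfun :: ('a::metric_space \<Rightarrow> real) set)"
proof -
  have zero: "(\<lambda>_. 0) = apply_bcontfun (0 :: 'a \<Rightarrow>\<^sub>C real)" by (rule ext) simp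
  have add: "(\<lambda>s. f s + g s) = apply_bcontfun (f + g)" for f g :: "'a \<Rightarrow>\<^sub>C real" by (rule ext) simp
  have diff: "(\<lambda>s. f s - g s) = apply_bcontfun (f - g)" for f g :: "'a \<Rightarrow>\<^sub>C real" by (rule ext) simp
  have scale: "(\<lambda>s. c * f s) = apply_bcontfun (c *\<^sub>R f)" for c and f :: "'a \<Rightarrow>\<^sub>C real" by (rule ext) simp
  have complete: "\<exists>f\<in>bcontfun. (\<lambda>n. sup_norm_on UNIV (\<lambda>s. u n s - f s)) \<longlonglongrightarrow> 0"
    if u: "\<forall>n. u n \<in> bcontfun"
      "\<forall>e>0. \<exists>N::nat. \<forall>m\<ge>N. \<forall>n\<ge>N. sup_norm_on UNIV (\<lambda>s. u m s - u n s) < e"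
    for u :: "nat \<Rightarrow> 'a \<Rightarrow> real"
  proof -
    define v where "v n = Bcontfun (u n)" for n
    have v: "u n = apply_bcontfun (v n)" for n
      using u(1) by (simp add: v_def Bcontfun_inverse)
    have "Cauchy v"
      using u(2) unfolding Cauchy_def v diff sup_norm_on_bcontfun dist_norm by blast
    then obtain f where f: "v \<longlonglongrightarrow> f" using convergent_eq_Cauchy by blast
    then have "(\<lambda>n. sup_norm_on UNIV (\<lambda>s. u n s - f s)) \<longlonglongrightarrow> 0"
      unfolding v diff sup_norm_on_bcontfun by (simp add: tendsto_norm_zero LIM_zero)
    then show ?thesis by (intro bexI[of _ "apply_bcontfun f"] apply_bcontfun)
  qed
  show ?thesis
    unfolding sup_norm_banach_def
  proof (intro conjI ballI allI impI)
    show "(\<lambda>_. 0) \<in> bcontfun" by (rule const_bcontfun)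
  next
    fix f :: "'a \<Rightarrow> real" assume "f \<in> bcontfun"
    then obtain f' where f: "f = apply_bcontfun f'" by (rule bcontfunE)
    show "bounded (range f)" unfolding f by simp
    show "0 \<le> sup_norm_on UNIV f" unfolding f sup_norm_on_bcontfun by simp
    show "sup_norm_on UNIV f = 0 \<longleftrightarrow> f = (\<lambda>_. 0)"
      unfolding f zero sup_norm_on_bcontfun apply_bcontfun_inject by simp
    show "(\<lambda>s. c * f s) \<in> bcontfun" for c
      unfolding f scale by (rule apply_bcontfun)
    show "sup_norm_on UNIV (\<lambda>s. c * f s) = \<bar>c\<bar> * sup_norm_on UNIV f" for c
      unfolding f scale sup_norm_on_bcontfun by simp
    fix g :: "'a \<Rightarrow> real" assume "g \<in> bcontfun"
    then obtain g' where g: "g = apply_bcontfun g'" by (rule bcontfunE)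
    show "(\<lambda>s. f s + g s) \<in> bcontfun"
      unfolding f g add by (rule apply_bcontfun)
    show "sup_norm_on UNIV (\<lambda>s. f s + g s) \<le> sup_norm_on UNIV f + sup_norm_on UNIV g"
      unfolding f g add sup_norm_on_bcontfun by (rule norm_triangle_ineq)
  qed (use complete in blast)
qed

lemma sup_norm_banach_C_Omega: "sup_norm_banach UNIV C_Omega"
proof -
  have "C_Omega = bcontfun"
    unfolding C_Omega_def bcontfun_def using bounded_continuous_bitseq by blast
  then show ?thesis using sup_norm_banach_bcontfun by metis
qed

text \<open>A linear isometry carries Cauchy sequences in \<open>V\<close> to Cauchy sequences in
  \<open>W\<close>, whose limits are pulled back by surjectivity. Injectivity gives definiteness of
  the norm.\<close>

lemma sup_norm_banach_transfer:
  assumes W: "sup_norm_banach S' W" and bij: "bij_betw T V W"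
    and isometric: "\<And>f. f \<in> V \<Longrightarrow> sup_norm_on S' (T f) = sup_norm_on S f"
    and add: "\<And>f g. f \<in> V \<Longrightarrow> g \<in> V \<Longrightarrow> T (\<lambda>s. f s + g s) = (\<lambda>x. T f x + T g x)"
    and scale: "\<And>c f. f \<in> V \<Longrightarrow> T (\<lambda>s. c * f s) = (\<lambda>x. c * T f x)"
    and V: "\<And>f g. f \<in> V \<Longrightarrow> g \<in> V \<Longrightarrow> (\<lambda>s. f s + g s) \<in> V"
      "\<And>c f. f \<in> V \<Longrightarrow> (\<lambda>s. c * f s) \<in> V" "\<And>f. f \<in> V \<Longrightarrow> bounded (f ` S)"
  shows "sup_norm_banach S V"
proof -
  have TW: "T f \<in> W" if "f \<in> V" for f using bij that by (auto simp: bij_betw_def)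
  note W_unfolded = W[unfolded sup_norm_banach_def]
  have W_zero_mem: "(\<lambda>_. 0) \<in> W"
    using W_unfolded by (elim conjE)
  have W_nonneg: "\<forall>f\<in>W. 0 \<le> sup_norm_on S' f"
    using W_unfolded by (elim conjE)
  have W_norm_zero: "\<forall>f\<in>W. sup_norm_on S' f = 0 \<longleftrightarrow> f = (\<lambda>_. 0)"
    using W_unfolded by (elim conjE)
  have W_scale: "\<forall>c. \<forall>f\<in>W. sup_norm_on S' (\<lambda>s. c * f s) = \<bar>c\<bar> * sup_norm_on S' f"
    using W_unfolded by (elim conjE)
  have W_triangle: "\<forall>f\<in>W. \<forall>g\<in>W. sup_norm_on S' (\<lambda>s. f s + g s) \<le> sup_norm_on S' f + sup_norm_on S' g"
    using W_unfolded by (elim conjE)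
  have W_complete: "\<forall>u. (\<forall>n. u n \<in> W) \<and>
        (\<forall>e>0. \<exists>N::nat. \<forall>m\<ge>N. \<forall>n\<ge>N. sup_norm_on S' (\<lambda>s. u m s - u n s) < e) \<longrightarrow>
      (\<exists>f\<in>W. (\<lambda>n. sup_norm_on S' (\<lambda>s. u n s - f s)) \<longlonglongrightarrow> 0)"
    using W_unfolded by (elim conjE)
  \<comment> \<open>The zero function arises as \<open>0\<close> times an element of
    \<open>V\<close>, which is inhabited because \<open>T\<close> maps onto
    \<open>W\<close>.\<close>
  from W_zero_mem obtain f0 where "f0 \<in> V" using bij by (auto simp: bij_betw_def)
  then have zero: "(\<lambda>_. 0) \<in> V" and T_zero: "T (\<lambda>_. 0) = (\<lambda>_. 0)"
    using V(2)[of f0 0] scale[of f0 0] by simp_all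
  have diff: "(\<lambda>s. f s - g s) \<in> V" "T (\<lambda>s. f s - g s) = (\<lambda>x. T f x - T g x)"
    if "f \<in> V" "g \<in> V" for f g
    using V(1)[OF that(1) V(2)[OF that(2), of "-1"]]
      add[OF that(1) V(2)[OF that(2), of "-1"]] scale[OF that(2), of "-1"] by simp_all
  have norm_diff: "sup_norm_on S (\<lambda>s. f s - g s) = sup_norm_on S' (\<lambda>x. T f x - T g x)"
    if "f \<in> V" "g \<in> V" for f g
    using isometric[OF diff(1)[OF that]] diff(2)[OF that] by simp
  have norm_zero: "sup_norm_on S f = 0 \<longleftrightarrow> f = (\<lambda>_. 0)" if "f \<in> V" for f
  proof -
    have "sup_norm_on S f = 0 \<longleftrightarrow> T f = (\<lambda>_. 0)"
      unfolding isometric[OF that, symmetric] by (rule bspec[OF W_norm_zero TW[OF that]])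
    also have "\<dots> \<longleftrightarrow> f = (\<lambda>_. 0)"
      using bij zero that T_zero by (metis bij_betw_def inj_onD)
    finally show ?thesis .
  qed
  have complete: "\<exists>f\<in>V. (\<lambda>n. sup_norm_on S (\<lambda>s. u n s - f s)) \<longlonglongrightarrow> 0"
    if u: "\<forall>n. u n \<in> V" "\<forall>e>0. \<exists>N::nat. \<forall>m\<ge>N. \<forall>n\<ge>N. sup_norm_on S (\<lambda>s. u m s - u n s) < e" for u
  proof -
    have "\<forall>e>0. \<exists>N::nat. \<forall>m\<ge>N. \<forall>n\<ge>N. sup_norm_on S' (\<lambda>x. T (u m) x - T (u n) x) < e"
      using u by (simp add: norm_diff)
    moreover have "\<forall>n. T (u n) \<in> W" using u(1) TW by blast
    ultimately obtain g where "g \<in> W" and g: "(\<lambda>n. sup_norm_on S' (\<lambda>x. T (u n) x - g x)) \<longlonglongrightarrow> 0"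
      using W_complete[rule_format, of "\<lambda>n. T (u n)"] by auto
    obtain f where "f \<in> V" "T f = g" using bij \<open>g \<in> W\<close> by (auto simp: bij_betw_def)
    then show ?thesis using g u(1) norm_diff by (intro bexI[of _ f]) auto
  qed
  show ?thesis
    unfolding sup_norm_banach_def
  proof (intro conjI ballI allI impI)
    fix f assume "f \<in> V"
    then show "0 \<le> sup_norm_on S f"
      using W_nonneg TW isometric by metis
    show "sup_norm_on S (\<lambda>s. c * f s) = \<bar>c\<bar> * sup_norm_on S f" for c
      using isometric[OF V(2)[OF \<open>f \<in> V\<close>, of c]] scale[OF \<open>f \<in> V\<close>, of c]
        bspec[OF spec[OF W_scale, of c] TW[OF \<open>f \<in> V\<close>]] isometric[OF \<open>f \<in> V\<close>] by simp
  next
    fix f g assume fg: "f \<in> V" "g \<in> V"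
    have "sup_norm_on S' (\<lambda>x. T f x + T g x) \<le> sup_norm_on S' (T f) + sup_norm_on S' (T g)"
      using W_triangle TW[OF fg(1)] TW[OF fg(2)] by blast
    then show "sup_norm_on S (\<lambda>s. f s + g s) \<le> sup_norm_on S f + sup_norm_on S g"
      using isometric[OF V(1)[OF fg]] add[OF fg] isometric fg by simp
  qed (use zero V norm_zero complete in auto)
qed

theorem theorem1:
  shows "sup_norm_banach {0..1} D01 \<and>
    sup_norm_banach UNIV C_Omega \<and>
    (\<forall>F\<in>D01. \<forall>G\<in>D01. Theta (\<lambda>s. F s + G s) = (\<lambda>x. Theta F x + Theta G x)) \<and>
    (\<forall>c. \<forall>F\<in>D01. Theta (\<lambda>s. c * F s) = (\<lambda>x. c * Theta F x)) \<and>
    bij_betw Theta D01 C_Omega \<and>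
    (\<forall>F\<in>D01. sup_norm_on UNIV (Theta F) = sup_norm_on {0..1} F)"
proof (intro conjI ballI allI)
  show "sup_norm_banach {0..1} D01"
    by (rule sup_norm_banach_transfer[OF sup_norm_banach_C_Omega bij_betw_Theta])
      (simp_all add: sup_norm_on_Theta Theta_add Theta_scale D01_add D01_scale bounded_D01)
qed (simp_all add: sup_norm_banach_C_Omega bij_betw_Theta sup_norm_on_Theta Theta_add Theta_scale)

end
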